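(* Let $R$ be a Noetherian commutative ring of prime characteristic $p>0$, let $I$ be a non-zero proper ideal of $R$, and let $\mathfrak{a}_\bullet$ be a filtration of ideals in $R$. Then $\mathcal{C}_+^I(\mathfrak{a}_\bullet)<\infty$ if and only if there exists a positive integer $M$ such that $\mathfrak{a}_{Mp^e}\subseteq I^{[p^e]}$ for all $e\gg 0$. Moreover, in this case, $\sqrt{\mathfrak{a}_\bullet}\subseteq\sqrt{I}$.
   Context: A filtration of ideals in $R$ is a sequence $\mathfrak{a}_\bullet=\{\mathfrak{a}_i\}_{i\ge 0}$ of ideals with $\mathfrak{a}_0=R$, $\mathfrak{a}_{i+1}\subseteq\mathfrak{a}_i$, and $\mathfrak{a}_i\mathfrak{a}_j\subseteq \mathfrak{a}_{i+j}$ for all $i,j\ge 0$. One has $\sqrt{\mathfrak{a}_i}=\sqrt{\mathfrak{a}_1}$ for all $i\ge 1$, and $\sqrt{\mathfrak{a}_\bullet}:=\sqrt{\mathfrak{a}_1}$. For an ideal $I$, $I^{[p^e]}$ is the ideal generated by all $f^{p^e}$, $f\in I$. For $e\ge 0$ put $\nu_{\mathfrak{a}_\bullet}^I(p^e)=\sup\{r\in\mathbb{Z}_{\ge 0}:\mathfrak{a}_r\not\subseteq I^{[p^e]}\}\in\mathbb{Z}_{\ge0}\cup\{\infty\}$, and $\mathcal{C}_+^I(\mathfrak{a}_\bullet)=\limsup_{e\to\infty}\nu_{\mathfrak{a}_\bullet}^I(p^e)/p^e$. *)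

theory Defs
  imports
    "HOL-Algebra.Ideal_Product"
    "HOL-Algebra.Ring_Divisibility"
    "HOL-Computational_Algebra.Primes"
    "HOL-Library.Extended_Real"
    "HOL-Library.Liminf_Limsup"
begin

definition ring_char :: "('a, 'b) ring_scheme \<Rightarrow> nat" where
  "ring_char R =
    (if \<exists>n::nat. n > 0 \<and> add_pow R n \<one>\<^bsub>R\<^esub> = \<zero>\<^bsub>R\<^esub>
     then LEAST n::nat. n > 0 \<and> add_pow R n \<one>\<^bsub>R\<^esub> = \<zero>\<^bsub>R\<^esub>
     else 0)"

definition ideal_radical :: "('a, 'b) ring_scheme \<Rightarrow> 'a set \<Rightarrow> 'a set" where
  "ideal_radical R J = {x \<in> carrier R. \<exists>n::nat. n > 0 \<and> x [^]\<^bsub>R\<^esub> n \<in> J}"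

definition ideal_filtration :: "('a, 'b) ring_scheme \<Rightarrow> (nat \<Rightarrow> 'a set) \<Rightarrow> bool" where
  "ideal_filtration R \<aa> \<longleftrightarrow>
     (\<forall>i. ideal (\<aa> i) R) \<and>
     \<aa> 0 = carrier R \<and>
     (\<forall>i. \<aa> (Suc i) \<subseteq> \<aa> i) \<and>
     (\<forall>i j. ideal_prod R (\<aa> i) (\<aa> j) \<subseteq> \<aa> (i + j))"

definition filtration_radical :: "('a, 'b) ring_scheme \<Rightarrow> (nat \<Rightarrow> 'a set) \<Rightarrow> 'a set" where
  "filtration_radical R \<aa> = ideal_radical R (\<aa> 1)"

text \<open>In \<open>frobenius_power\<close> and \<open>nu\<close> the argument \<open>q\<close> stands for the power \<open>p ^ e\<close> of the
  characteristic.\<close>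

definition frobenius_power :: "('a, 'b) ring_scheme \<Rightarrow> 'a set \<Rightarrow> nat \<Rightarrow> 'a set" where
  "frobenius_power R I q = genideal R {f [^]\<^bsub>R\<^esub> q | f. f \<in> I}"

text \<open>For a proper ideal \<open>I\<close> and a filtration \<open>\<aa>\<close> the index \<open>0\<close> always belongs to the set below,
  so the convention \<open>Sup {} = 0\<close> of \<^typ>\<open>enat\<close> plays no role.\<close>

definition nu :: "('a, 'b) ring_scheme \<Rightarrow> 'a set \<Rightarrow> (nat \<Rightarrow> 'a set) \<Rightarrow> nat \<Rightarrow> enat" where
  "nu R I \<aa> q = Sup {enat r | r. \<not> \<aa> r \<subseteq> frobenius_power R I q}"

definition C_plus ::
  "('a, 'b) ring_scheme \<Rightarrow> nat \<Rightarrow> 'a set \<Rightarrow> (nat \<Rightarrow> 'a set) \<Rightarrow> ereal" where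
  "C_plus R p I \<aa> = limsup (\<lambda>e. ereal_of_enat (nu R I \<aa> (p ^ e)) / ereal (real (p ^ e)))"

end

theory Submission
  imports Defs
begin

text \<open>Write q = p^e and I^[q] for the Frobenius power. Because the filtration is decreasing, a
  containment of \<aa>_m in I^[q] persists for all larger indices and so caps \<open>nu\<close> at
  m; conversely, any index strictly above \<open>nu\<close> gives a containment. With m = M q,
  dividing by q turns these two facts into bounds on \<open>nu\<close> / q that are eventually
  uniform in e, which is exactly finiteness of the limsup (\<open>C_plus_less_infinity_iff\<close>).
  For the radicals, a single containment of \<aa>_m in I^[q] with m, q > 0 is enough: if x^n lies in
  \<aa>_1, then x^(nm) lies in \<aa>_m by multiplicativity, hence in I^[q], hence in I
  (\<open>filtration_radical_subset\<close>).\<close>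

lemma (in cring) frobenius_power_subset:
  assumes "ideal I R" and "q > 0"
  shows "frobenius_power R I q \<subseteq> I"
  unfolding frobenius_power_def
proof (rule genideal_minimal[OF assms(1)], safe)
  interpret ideal I R by (rule assms(1))
  fix f assume f: "f \<in> I"
  \<comment> \<open>Positivity of q splits off a factor f of f^q; for q = 0 the generator would be
    1.\<close>
  obtain k where "q = Suc k" using \<open>q > 0\<close> gr0_implies_Suc by blast
  then show "f [^] q \<in> I" using f by (simp add: I_l_closed)
qed

lemma ideal_filtration_antimono:
  assumes "ideal_filtration R \<aa>" and "r \<le> s"
  shows "\<aa> s \<subseteq> \<aa> r"
proof (rule lift_Suc_antimono_le)
  show "\<aa> (Suc i) \<subseteq> \<aa> i" for i
    using assms(1) by (simp add: ideal_filtration_def)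
qed (rule assms(2))

text \<open>Induction on k from 1 in \<aa>_0 = R, each further factor x raising the index by n. This
  lets powers of an element of \<aa>_1 reach any prescribed depth.\<close>

lemma (in cring) ideal_filtration_pow_closed:
  assumes filt: "ideal_filtration R \<aa>" and x: "x \<in> \<aa> n"
  shows "x [^] (k::nat) \<in> \<aa> (k * n)"
proof (induction k)
  case 0
  then show ?case using filt by (simp add: ideal_filtration_def)
next
  case (Suc k)
  then have "x [^] k \<otimes> x \<in> ideal_prod R (\<aa> (k * n)) (\<aa> n)"
    using x by (rule ideal_prod.prod)
  moreover have "ideal_prod R (\<aa> (k * n)) (\<aa> n) \<subseteq> \<aa> (k * n + n)"
    using filt by (simp add: ideal_filtration_def)
  ultimately show ?case by (auto simp: add.commute)
qed

lemma subset_frobenius_power_if_nu_less: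
  assumes "nu R I \<aa> q < enat r"
  shows "\<aa> r \<subseteq> frobenius_power R I q"
proof (rule ccontr)
  assume "\<not> \<aa> r \<subseteq> frobenius_power R I q"
  then have "enat r \<le> nu R I \<aa> q" unfolding nu_def by (intro Sup_upper) blast
  with assms show False by simp
qed

text \<open>An index r \<ge> m cannot violate the containment, since \<aa>_r lies inside \<aa>_m; so
  m bounds the set whose supremum is \<open>nu\<close>.\<close>

lemma nu_le_if_subset_frobenius_power:
  assumes "ideal_filtration R \<aa>" and "\<aa> m \<subseteq> frobenius_power R I q"
  shows "nu R I \<aa> q \<le> enat m"
  unfolding nu_def
proof (rule Sup_least)
  fix x assume "x \<in> {enat r | r. \<not> \<aa> r \<subseteq> frobenius_power R I q}"
  then obtain r where r: "x = enat r" "\<not> \<aa> r \<subseteq> frobenius_power R I q" by blast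
  with assms have "\<not> m \<le> r" using ideal_filtration_antimono by blast
  with r show "x \<le> enat m" by simp
qed

lemma C_plus_less_infinity_iff:
  assumes filt: "ideal_filtration R \<aa>" and p: "p > 0"
  shows "C_plus R p I \<aa> < \<infinity> \<longleftrightarrow>
    (\<exists>M::nat. M > 0 \<and>
       (\<forall>\<^sub>F e in sequentially. \<aa> (M * p ^ e) \<subseteq> frobenius_power R I (p ^ e)))"
proof
  assume "C_plus R p I \<aa> < \<infinity>"
  then obtain M :: nat where "C_plus R p I \<aa> < ereal (real M)"
    using less_PInf_Ex_of_nat[of "C_plus R p I \<aa>"] by auto
  \<comment> \<open>Passing to \<open>Suc M\<close> makes the constant visibly positive, as the
    conclusion demands.\<close>
  also have "ereal (real M) < ereal (real (Suc M))" by simp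
  finally have "C_plus R p I \<aa> < ereal (real (Suc M))" .
  then have "\<forall>\<^sub>F e in sequentially.
      ereal_of_enat (nu R I \<aa> (p ^ e)) / ereal (real (p ^ e)) < ereal (real (Suc M))"
    unfolding C_plus_def by (rule Limsup_lessD)
  then have "\<forall>\<^sub>F e in sequentially. \<aa> (Suc M * p ^ e) \<subseteq> frobenius_power R I (p ^ e)"
  proof eventually_elim
    case (elim e)
    have pos: "real (p ^ e) > 0" using p by simp
    \<comment> \<open>An infinite \<open>nu\<close> would make the quotient infinite, against the
      bound.\<close>
    obtain n where n: "nu R I \<aa> (p ^ e) = enat n"
      using elim pos by (cases "nu R I \<aa> (p ^ e)") auto
    with elim p have "real n / real (p ^ e) < real (Suc M)" by simp
    with pos have "real n < real (Suc M * p ^ e)" by (simp only: pos_divide_less_eq of_nat_mult)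
    then have "n < Suc M * p ^ e" by (simp only: of_nat_less_iff)
    with n have "nu R I \<aa> (p ^ e) < enat (Suc M * p ^ e)" by simp
    then show ?case by (rule subset_frobenius_power_if_nu_less)
  qed
  then show "\<exists>M::nat. M > 0 \<and>
      (\<forall>\<^sub>F e in sequentially. \<aa> (M * p ^ e) \<subseteq> frobenius_power R I (p ^ e))"
    by (intro exI[of _ "Suc M"] conjI) simp_all
next
  assume "\<exists>M::nat. M > 0 \<and>
      (\<forall>\<^sub>F e in sequentially. \<aa> (M * p ^ e) \<subseteq> frobenius_power R I (p ^ e))"
  then obtain M :: nat where
    "\<forall>\<^sub>F e in sequentially. \<aa> (M * p ^ e) \<subseteq> frobenius_power R I (p ^ e)"
    by blast
  \<comment> \<open>A non-strict bound suffices here, because an eventual upper bound passes to the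
    limsup.\<close>
  then have "\<forall>\<^sub>F e in sequentially.
      ereal_of_enat (nu R I \<aa> (p ^ e)) / ereal (real (p ^ e)) \<le> ereal (real M)"
  proof eventually_elim
    case (elim e)
    have pos: "real (p ^ e) > 0" using p by simp
    obtain n where n: "nu R I \<aa> (p ^ e) = enat n" "n \<le> M * p ^ e"
      using nu_le_if_subset_frobenius_power[OF filt elim] by (cases "nu R I \<aa> (p ^ e)") auto
    then have "real n \<le> real (M * p ^ e)" by (simp only: of_nat_le_iff)
    with pos have "real n / real (p ^ e) \<le> real M" by (simp only: pos_divide_le_eq of_nat_mult)
    with n p show ?case by simp
  qed
  then have "C_plus R p I \<aa> \<le> ereal (real M)"
    unfolding C_plus_def by (rule Limsup_bounded)
  then show "C_plus R p I \<aa> < \<infinity>" by (rule le_less_trans) simp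
qed

lemma (in cring) filtration_radical_subset:
  assumes I: "ideal I R" and filt: "ideal_filtration R \<aa>"
    and m: "m > 0" and q: "q > 0" and sub: "\<aa> m \<subseteq> frobenius_power R I q"
  shows "filtration_radical R \<aa> \<subseteq> ideal_radical R I"
proof
  fix x assume "x \<in> filtration_radical R \<aa>"
  then obtain n :: nat where x: "x \<in> carrier R" and n: "n > 0" and xn: "x [^] n \<in> \<aa> 1"
    by (auto simp: filtration_radical_def ideal_radical_def)
  have "x [^] (n * m) \<in> \<aa> m"
    using ideal_filtration_pow_closed[OF filt xn, of m] x by (simp add: nat_pow_pow)
  then have "x [^] (n * m) \<in> I" using sub frobenius_power_subset[OF I q] by blast
  then show "x \<in> ideal_radical R I"
    using x n m by (auto simp: ideal_radical_def intro!: exI[of _ "n * m"])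
qed

theorem lemma3p11:
  fixes R :: "('a, 'b) ring_scheme" and p :: nat
    and I :: "'a set" and \<aa> :: "nat \<Rightarrow> 'a set"
  assumes "cring R" and "noetherian_ring R"
    and "Factorial_Ring.prime p" and "ring_char R = p"
    and "ideal I R" and "I \<noteq> {\<zero>\<^bsub>R\<^esub>}" and "I \<noteq> carrier R"
    and "ideal_filtration R \<aa>"
  shows "(C_plus R p I \<aa> < \<infinity> \<longleftrightarrow>
            (\<exists>M::nat. M > 0 \<and>
               (\<forall>\<^sub>F e in sequentially. \<aa> (M * p ^ e) \<subseteq> frobenius_power R I (p ^ e))))
         \<and> (C_plus R p I \<aa> < \<infinity> \<longrightarrow> filtration_radical R \<aa> \<subseteq> ideal_radical R I)"
proof -
  interpret cring R by (rule assms(1))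
  have p: "p > 0" using assms(3) by (rule prime_gt_0_nat)
  note finite_iff = C_plus_less_infinity_iff[OF assms(8) p, of I]
  have "filtration_radical R \<aa> \<subseteq> ideal_radical R I" if fin: "C_plus R p I \<aa> < \<infinity>"
  proof -
    obtain M where "M > 0"
      and "\<forall>\<^sub>F e in sequentially. \<aa> (M * p ^ e) \<subseteq> frobenius_power R I (p ^ e)"
      using iffD1[OF finite_iff fin] by (elim exE conjE)
    \<comment> \<open>A property that holds eventually along the naturals holds for at least one e,
      and one is enough for the radicals.\<close>
    moreover from this(2) obtain e where "\<aa> (M * p ^ e) \<subseteq> frobenius_power R I (p ^ e)"
      by (auto dest: eventually_happens'[OF sequentially_bot])
    ultimately show ?thesis
      using p by (intro filtration_radical_subset[OF assms(5,8), of "M * p ^ e" "p ^ e"]) auto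
  qed
  with finite_iff show ?thesis by (intro conjI impI)
qed

end
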